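(* There is exactly one equilibrium, i.e. exactly one pair consisting of a queueing profile $Q:\mathcal{T}\to[0,\infty)$ and a traveler order (arrival time function) $t:[0,N]\to\mathcal{T}$ such that $(Q,t)$ is an equilibrium.
   Context: $N>0$ (mass of travelers) and $s>0$ (bottleneck capacity) are real numbers. Travelers are indexed by $n\in[0,N]$. $\beta:[0,N]\to(0,1)$ is continuous and strictly increasing (earliness penalty), and $\gamma:[0,N]\to(0,\infty)$ is continuous and strictly decreasing (lateness penalty). Time is measured relative to the preferred arrival time $0$, and $\mathcal{T}=[-N/s,N/s]$. Write $[x]^+=\max\{x,0\}$. A (feasible) solution is a pair $(Q,t)$, where $Q:\mathcal{T}\to[0,\infty)$ is the queueing delay profile ($Q(t)$ is the queueing delay of a traveler arriving at time $t$) and $t:[0,N]\to\mathcal{T}$ is injective and measurable ($t(n)$ is the arrival time of traveler $n$), with inverse function $n(\cdot)$ defined on the set of arrival times, such that: (i) the support $\{t\in\mathcal{T}:Q(t)>0\}$ has total width (Lebesgue measure) at most $N/s$; (ii) (first-in, first-out) $Q(t_2)-Q(t_1)<t_2-t_1$ for all $t_1<t_2$ in $\mathcal{T}$ (in particular $Q$ has no positive jumps; negative jumps are allowed); (iii) (bottleneck of capacity $s$, discharging at capacity whenever the queue is active) for every interval $I\subseteq\mathcal{T}$ of length $\ell$, the Lebesgue measure of $\{n:t(n)\in I\}$ is at most $s\ell$, and it equals $s\ell$ if $Q>0$ throughout $I$; moreover every time $t$ with $Q(t)>0$ is the arrival time of some traveler $n(t)$. The cost of traveler $n$ when arriving at time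 $t$ is $C_n(t)=Q(t)+\beta(n)[-t]^+ +\gamma(n)[t]^+$. A feasible pair $(Q,t)$ is an equilibrium if $C_n(t(n))=\min_{u\in\mathcal{T}}C_n(u)$ for all $n\in[0,N]$. *)

theory Defs
  imports "HOL-Analysis.Analysis"
begin

definition time_window :: "real \<Rightarrow> real \<Rightarrow> real set" where
  "time_window N s = {- (N / s)..N / s}"

text \<open>
  Functions on a bounded domain are extensional (the space \<open>\<rightarrow>\<^sub>E\<close>), so that equality
  of HOL functions is equality on the domain. In the capacity clause \<open>I\<close>
  ranges over all intervals (open, closed, half-open, degenerate), and the length of \<open>I\<close> is
  its Lebesgue measure. The set on which \<open>Q\<close> is positive needs no separate measurability
  assumption: by the first-in, first-out clause, \<open>Q u - u\<close> is strictly decreasing in \<open>u\<close>.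
\<close>

definition feasible ::
  "real \<Rightarrow> real \<Rightarrow> (real \<Rightarrow> real) \<Rightarrow> (real \<Rightarrow> real) \<Rightarrow> bool" where
  "feasible N s Q t \<longleftrightarrow>
     Q \<in> time_window N s \<rightarrow>\<^sub>E {0..} \<and>
     t \<in> {0..N} \<rightarrow>\<^sub>E time_window N s \<and>
     inj_on t {0..N} \<and>
     t \<in> borel_measurable (lebesgue_on {0..N}) \<and>
     measure lebesgue {u \<in> time_window N s. Q u > 0} \<le> N / s \<and>
     (\<forall>t1 \<in> time_window N s. \<forall>t2 \<in> time_window N s. t1 < t2 \<longrightarrow> Q t2 - Q t1 < t2 - t1) \<and>
     (\<forall>I. is_interval I \<and> I \<subseteq> time_window N s \<longrightarrow>
        measure lebesgue {n \<in> {0..N}. t n \<in> I} \<le> s * measure lebesgue I \<and>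
        ((\<forall>u \<in> I. Q u > 0) \<longrightarrow>
           measure lebesgue {n \<in> {0..N}. t n \<in> I} = s * measure lebesgue I)) \<and>
     (\<forall>u \<in> time_window N s. Q u > 0 \<longrightarrow> (\<exists>n \<in> {0..N}. t n = u))"

definition travel_cost ::
  "(real \<Rightarrow> real) \<Rightarrow> (real \<Rightarrow> real) \<Rightarrow> (real \<Rightarrow> real) \<Rightarrow> real \<Rightarrow> real \<Rightarrow> real" where
  "travel_cost \<beta> \<gamma> Q n u = Q u + \<beta> n * max (- u) 0 + \<gamma> n * max u 0"

definition equilibrium ::
  "real \<Rightarrow> real \<Rightarrow> (real \<Rightarrow> real) \<Rightarrow> (real \<Rightarrow> real) \<Rightarrow> (real \<Rightarrow> real) \<Rightarrow> (real \<Rightarrow> real) \<Rightarrow> bool" where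
  "equilibrium N s \<beta> \<gamma> Q t \<longleftrightarrow>
     feasible N s Q t \<and>
     (\<forall>n \<in> {0..N}. is_arg_min (travel_cost \<beta> \<gamma> Q n) (\<lambda>u. u \<in> time_window N s) (t n))"

end

theory Submission imports Defs begin

text \<open>
  By single crossing, travelers arrive in the order of their index, and they do so at capacity
  around the traveler \<open>k\<close> who arrives on time; hence \<open>t n = (n - k) / s\<close>. In the time scale
  \<open>x = k + s * u\<close>, cost minimality makes \<open>\<beta>\<close> a subgradient of the rescaled queue on \<open>[0, k]\<close> and
  \<open>- \<gamma>\<close> a subgradient of it on \<open>[k, N]\<close>. Continuous subgradients are derivatives, and the queue
  vanishes at \<open>0\<close> and \<open>N\<close>, so it is the integral of \<open>\<beta>\<close> over \<open>[0, x]\<close> before \<open>k\<close> and the integral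
  of \<open>\<gamma>\<close> over \<open>[x, N]\<close> after \<open>k\<close>. The two agree at \<open>k\<close>, which determines \<open>k\<close>. Conversely, this
  queue is the minimum of the two integrals, and their tangent bounds show that it is an equilibrium.
\<close>

section \<open>Subgradients of functions of one real variable\<close>

definition subgradient_on :: "real set \<Rightarrow> (real \<Rightarrow> real) \<Rightarrow> (real \<Rightarrow> real) \<Rightarrow> bool" where
  "subgradient_on S g f \<longleftrightarrow> (\<forall>x\<in>S. \<forall>y\<in>S. f x + g x * (y - x) \<le> f y)"

lemma subgradient_onD:
  "subgradient_on S g f \<Longrightarrow> x \<in> S \<Longrightarrow> y \<in> S \<Longrightarrow> f x + g x * (y - x) \<le> f y"
  unfolding subgradient_on_def by blast

lemma subgradient_on_subset: "subgradient_on S g f \<Longrightarrow> T \<subseteq> S \<Longrightarrow> subgradient_on T g f"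
  unfolding subgradient_on_def by blast

text \<open>By the mean value theorem, an increment of the integral is the length of the step times
  \<open>g\<close> at an intermediate point. Monotonicity compares that value with
  \<open>g x\<close>, on either side of \<open>x\<close>.\<close>

lemma subgradient_on_integral:
  fixes g :: "real \<Rightarrow> real"
  assumes "continuous_on {a..b} g" and mono: "mono_on {a..b} g"
  shows "subgradient_on {a..b} g (\<lambda>x. integral {a..x} g)"
  unfolding subgradient_on_def
proof (intro ballI)
  let ?F = "\<lambda>x. integral {a..x} g"
  have mean: "\<exists>z\<in>{p<..<q}. ?F q - ?F p = g z * (q - p)"
    if "p < q" "p \<in> {a..b}" "q \<in> {a..b}" for p q
  proof (rule mvt_simple[OF \<open>p < q\<close>])
    fix x assume "p \<le> x" "x \<le> q"
    then have "(?F has_real_derivative g x) (at x within {a..b})"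
      using that by (intro integral_has_real_derivative assms(1)) auto
    then show "(?F has_derivative (*) (g x)) (at x within {p..q})"
      unfolding has_field_derivative_def
      by (rule has_derivative_subset) (use that in auto)
  qed
  fix x y assume xy: "x \<in> {a..b}" "y \<in> {a..b}"
  consider "x = y" | "x < y" | "y < x" by linarith
  then show "?F x + g x * (y - x) \<le> ?F y"
  proof cases
    case 2
    then obtain z where z: "z \<in> {x<..<y}" "?F y - ?F x = g z * (y - x)"
      using mean xy by blast
    have "g x \<le> g z" using z xy by (intro mono_onD[OF mono]) auto
    then have "g x * (y - x) \<le> g z * (y - x)" using 2 by (intro mult_right_mono) auto
    then show ?thesis using z by linarith
  next
    case 3
    then obtain z where z: "z \<in> {y<..<x}" "?F x - ?F y = g z * (x - y)"
      using mean xy by blast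
    have "g z \<le> g x" using z xy by (intro mono_onD[OF mono]) auto
    then have "g z * (x - y) \<le> g x * (x - y)" using 3 by (intro mult_right_mono) auto
    then show ?thesis using z by (simp add: algebra_simps)
  qed simp
qed

text \<open>The inequalities at \<open>x\<close> and at \<open>y\<close> together trap the
  difference quotient between \<open>g x\<close> and \<open>g y\<close>, and continuity of
  \<open>g\<close> squeezes it to \<open>g x\<close>. Neither convexity nor continuity of
  \<open>f\<close> has to be known beforehand.\<close>

lemma subgradient_on_imp_has_derivative:
  assumes sub: "subgradient_on S g f" and "continuous_on S g" and "x \<in> S"
  shows "(f has_real_derivative g x) (at x within S)"
proof -
  have "\<forall>\<^sub>F y in at x within S. norm ((f y - f x) / (y - x) - g x) \<le> \<bar>g y - g x\<bar>"
    unfolding eventually_at_filter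
  proof (rule eventuallyI, intro impI)
    fix y assume "y \<noteq> x" "y \<in> S"
    have 1: "g x * (y - x) \<le> f y - f x" "f y - f x \<le> g y * (y - x)"
      using subgradient_onD[OF sub \<open>x \<in> S\<close> \<open>y \<in> S\<close>] subgradient_onD[OF sub \<open>y \<in> S\<close> \<open>x \<in> S\<close>]
      by (simp_all add: algebra_simps)
    consider "x < y" | "y < x" using \<open>y \<noteq> x\<close> by linarith
    then show "norm ((f y - f x) / (y - x) - g x) \<le> \<bar>g y - g x\<bar>"
    proof cases
      case 1
      then have "g x \<le> (f y - f x) / (y - x)" "(f y - f x) / (y - x) \<le> g y"
        using \<open>g x * (y - x) \<le> f y - f x\<close> \<open>f y - f x \<le> g y * (y - x)\<close>
        by (simp_all add: field_simps)
      then show ?thesis by simp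
    next
      case 2
      then have "g x \<ge> (f y - f x) / (y - x)" "(f y - f x) / (y - x) \<ge> g y"
        using \<open>g x * (y - x) \<le> f y - f x\<close> \<open>f y - f x \<le> g y * (y - x)\<close>
        by (simp_all add: divide_le_eq le_divide_eq)
      then show ?thesis by simp
    qed
  qed
  moreover have "((\<lambda>y. \<bar>g y - g x\<bar>) \<longlongrightarrow> 0) (at x within S)"
    using assms(2,3) unfolding continuous_on_def
    by (metis LIM_zero tendsto_rabs_zero)
  ultimately have "((\<lambda>y. (f y - f x) / (y - x) - g x) \<longlongrightarrow> 0) (at x within S)"
    by (rule Lim_null_comparison)
  then show ?thesis
    unfolding has_field_derivative_iff by (rule LIM_zero_cancel)
qed

text \<open>Both functions have derivative \<open>g\<close>, so their difference is constant; one
  common value then identifies them.\<close>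

lemma subgradient_on_unique:
  assumes "subgradient_on S g f" "subgradient_on S g h" "continuous_on S g" "convex S"
    and "x \<in> S" "y \<in> S"
  shows "f x - h x = f y - h y"
proof -
  have "((\<lambda>x. f x - h x) has_real_derivative 0) (at x within S)" if "x \<in> S" for x
    using DERIV_diff[OF subgradient_on_imp_has_derivative[OF assms(1,3) that]
        subgradient_on_imp_has_derivative[OF assms(2,3) that]] by simp
  then show ?thesis
    using has_field_derivative_zero_constant[OF \<open>convex S\<close>, of "\<lambda>x. f x - h x"] assms by fastforce
qed

section \<open>The two integrals, the candidate queue and the balance point\<close>

locale bottleneck =
  fixes N s :: real and \<beta> \<gamma> :: "real \<Rightarrow> real"
  assumes N_pos: "N > 0" and s_pos: "s > 0"
    and \<beta>_range: "\<beta> \<in> {0..N} \<rightarrow> {0<..<1}"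
    and \<beta>_cont: "continuous_on {0..N} \<beta>" and \<beta>_mono: "strict_mono_on {0..N} \<beta>"
    and \<gamma>_range: "\<gamma> \<in> {0..N} \<rightarrow> {0<..}"
    and \<gamma>_cont: "continuous_on {0..N} \<gamma>" and \<gamma>_anti: "strict_antimono_on {0..N} \<gamma>"
begin

lemma \<beta>_bounds: "n \<in> {0..N} \<Longrightarrow> 0 < \<beta> n \<and> \<beta> n < 1"
  using \<beta>_range by auto

lemma \<gamma>_pos: "n \<in> {0..N} \<Longrightarrow> 0 < \<gamma> n"
  using \<gamma>_range by auto

lemma \<beta>_le: "x \<in> {0..N} \<Longrightarrow> y \<in> {0..N} \<Longrightarrow> x \<le> y \<Longrightarrow> \<beta> x \<le> \<beta> y"
  using strict_mono_onD[OF \<beta>_mono, of x y] by (cases "x = y") auto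

lemma \<gamma>_ge: "x \<in> {0..N} \<Longrightarrow> y \<in> {0..N} \<Longrightarrow> x \<le> y \<Longrightarrow> \<gamma> y \<le> \<gamma> x"
  using monotone_onD[OF \<gamma>_anti, of x y] by (cases "x = y") auto

definition early :: "real \<Rightarrow> real" where
  "early x = integral {0..x} \<beta>"

text \<open>This is \<open>integral {x..N} \<gamma>\<close>, written so that it visibly has derivative \<open>- \<gamma>\<close>.\<close>

definition late :: "real \<Rightarrow> real" where
  "late x = integral {0..x} (\<lambda>n. - \<gamma> n) - integral {0..N} (\<lambda>n. - \<gamma> n)"

text \<open>The minimum keeps \<open>k\<close> out of the formula; \<open>queue_early\<close> and
  \<open>queue_late\<close> recover the two branches.\<close>

definition queue :: "real \<Rightarrow> real" where
  "queue x = min (early x) (late x)"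

text \<open>Since \<open>queue\<close> vanishes at \<open>0\<close> and \<open>N\<close>, composing
  it with \<open>clamp\<close> extends it by zero to positions that no traveler occupies.\<close>

definition clamp :: "real \<Rightarrow> real" where
  "clamp x = max 0 (min N x)"

text \<open>The position at time \<open>u\<close> is \<open>k + s * u\<close>, and dividing by
  \<open>s\<close> turns the rescaled queue into a delay. \<open>restrict\<close> provides the
  extensionality that \<open>feasible\<close> demands.\<close>

definition eq_queue :: "real \<Rightarrow> real \<Rightarrow> real" where
  "eq_queue k = restrict (\<lambda>u. queue (clamp (k + s * u)) / s) (time_window N s)"

definition eq_time :: "real \<Rightarrow> real \<Rightarrow> real" where
  "eq_time k = restrict (\<lambda>n. (n - k) / s) {0..N}"

lemma early_subgradient: "subgradient_on {0..N} \<beta> early"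
  unfolding early_def
  by (intro subgradient_on_integral \<beta>_cont mono_onI \<beta>_le)

lemma late_subgradient: "subgradient_on {0..N} (\<lambda>n. - \<gamma> n) late"
proof -
  have "subgradient_on {0..N} (\<lambda>n. - \<gamma> n) (\<lambda>x. integral {0..x} (\<lambda>n. - \<gamma> n))"
    by (intro subgradient_on_integral continuous_on_minus \<gamma>_cont mono_onI) (simp add: \<gamma>_ge)
  then show ?thesis unfolding subgradient_on_def late_def by fastforce
qed

lemmas early_bound = subgradient_onD[OF early_subgradient]
lemmas late_bound = subgradient_onD[OF late_subgradient]

lemma early_0: "early 0 = 0" and late_N: "late N = 0"
  by (simp_all add: early_def late_def)

lemma early_less: "x \<in> {0..N} \<Longrightarrow> y \<in> {0..N} \<Longrightarrow> x < y \<Longrightarrow> early x < early y"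
  using early_bound[of x y] mult_pos_pos[of "\<beta> x" "y - x"] \<beta>_bounds[of x] by linarith

lemma late_less: "x \<in> {0..N} \<Longrightarrow> y \<in> {0..N} \<Longrightarrow> x < y \<Longrightarrow> late y < late x"
  using late_bound[of y x] mult_pos_neg[of "\<gamma> y" "x - y"] \<gamma>_pos[of y] by linarith

text \<open>The bound \<open>\<beta> < 1\<close> enters here; it is the source of the first-in,
  first-out property.\<close>

lemma early_growth:
  assumes "x \<in> {0..N}" "y \<in> {0..N}" "x < y"
  shows "early y - early x < y - x"
proof -
  have "early y - early x \<le> \<beta> y * (y - x)"
    using early_bound[of y x] assms by (simp add: algebra_simps)
  also have "\<dots> < 1 * (y - x)"
    using assms \<beta>_bounds[of y] by (intro mult_strict_right_mono) auto
  finally show ?thesis by simp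
qed

text \<open>Whichever branch attains the minimum at \<open>x\<close> bounds \<open>queue y\<close>
  from above: \<open>early\<close> grows by less than \<open>y - x\<close>, and \<open>late\<close>
  decreases.\<close>

lemma queue_growth:
  assumes "x \<in> {0..N}" "y \<in> {0..N}" "x < y"
  shows "queue y - queue x < y - x"
  using early_growth[OF assms] late_less[OF assms] assms(3) unfolding queue_def by linarith

lemma queue_pos: "0 < x \<Longrightarrow> x < N \<Longrightarrow> 0 < queue x"
  using early_less[of 0 x] late_less[of x N] early_0 late_N by (auto simp: queue_def)

lemma queue_0: "queue 0 = 0" and queue_N: "queue N = 0"
  using early_0 late_N early_less[of 0 N] late_less[of 0 N] N_pos by (auto simp: queue_def)

lemma queue_nonneg: "x \<in> {0..N} \<Longrightarrow> 0 \<le> queue x"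
  using queue_pos[of x] queue_0 queue_N by (cases "x = 0 \<or> x = N") fastforce+

lemma clamp_in: "clamp x \<in> {0..N}"
  using N_pos by (auto simp: clamp_def)

text \<open>Intermediate value theorem: \<open>early - late\<close> is at most 0 at \<open>0\<close>
  and at least 0 at \<open>N\<close>.\<close>

lemma balance_exists: "\<exists>k\<in>{0..N}. early k = late k"
proof -
  have "continuous_on {0..N} early" "continuous_on {0..N} late"
    using DERIV_continuous_on[OF subgradient_on_imp_has_derivative[OF early_subgradient \<beta>_cont]]
      DERIV_continuous_on[OF subgradient_on_imp_has_derivative
        [OF late_subgradient continuous_on_minus[OF \<gamma>_cont]]]
    by blast+
  then have "continuous_on {0..N} (\<lambda>x. early x - late x)"
    by (rule continuous_on_diff)
  moreover have "early 0 - late 0 \<le> 0" "0 \<le> early N - late N"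
    using early_0 late_N early_less[of 0 N] late_less[of 0 N] N_pos by auto
  ultimately obtain k where "0 \<le> k" "k \<le> N" "early k - late k = 0"
    using IVT'[of "\<lambda>x. early x - late x" 0 0 N] N_pos by auto
  then show ?thesis by auto
qed

lemma balance_unique:
  assumes "k \<in> {0..N}" "early k = late k" "k' \<in> {0..N}" "early k' = late k'"
  shows "k = k'"
  using early_less[of k k'] early_less[of k' k] late_less[of k k'] late_less[of k' k] assms
  by (cases k k' rule: linorder_cases) auto

text \<open>\<open>early\<close> increases and \<open>late\<close> decreases, so before their
  crossing at \<open>k\<close> the smaller one is \<open>early\<close>.\<close>

lemma queue_early: "k \<in> {0..N} \<Longrightarrow> early k = late k \<Longrightarrow> x \<in> {0..k} \<Longrightarrow> queue x = early x"
  using early_less[of x k] late_less[of x k] by (cases "x = k") (auto simp: queue_def)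

lemma queue_late: "k \<in> {0..N} \<Longrightarrow> early k = late k \<Longrightarrow> x \<in> {k..N} \<Longrightarrow> queue x = late x"
  using early_less[of k x] late_less[of k x] by (cases "x = k") (auto simp: queue_def)

section \<open>Existence: the candidate is an equilibrium\<close>

text \<open>Traveler positions \<open>x = k + s * u\<close> serve as the time scale: arrival in natural order at
  capacity then means that traveler \<open>n\<close> arrives at position \<open>n\<close>.\<close>

definition scaled_cost :: "real \<Rightarrow> (real \<Rightarrow> real) \<Rightarrow> real \<Rightarrow> real \<Rightarrow> real" where
  "scaled_cost k R n x = R x + \<beta> n * max (k - x) 0 + \<gamma> n * max (x - k) 0"

text \<open>The positive factor \<open>s\<close> passes through \<open>max\<close>. Comparisons of
  costs over time thus become comparisons over positions.\<close>

lemma travel_cost_scaled: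
  "s * travel_cost \<beta> \<gamma> Q n ((x - k) / s) = scaled_cost k (\<lambda>x. s * Q ((x - k) / s)) n x"
proof -
  have "s * max (- ((x - k) / s)) 0 = max (k - x) 0" "s * max ((x - k) / s) 0 = max (x - k) 0"
    using s_pos by (auto simp: max_def field_simps)
  then have "s * (\<beta> n * max (- ((x - k) / s)) 0) = \<beta> n * max (k - x) 0"
    "s * (\<gamma> n * max ((x - k) / s) 0) = \<gamma> n * max (x - k) 0"
    by (metis mult.left_commute)+
  then show ?thesis
    unfolding travel_cost_def scaled_cost_def by (simp only: distrib_left)
qed

text \<open>On the side of \<open>k\<close> where \<open>n\<close> lies, this is the tangent bound
  at \<open>n\<close>. Across \<open>k\<close>, the tangent bounds at \<open>n\<close> and at
  \<open>k\<close> are chained through the common value \<open>early k = late k\<close>.\<close>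

lemma scaled_cost_minimal:
  assumes k: "k \<in> {0..N}" "early k = late k" and n: "n \<in> {0..N}"
  shows "scaled_cost k (\<lambda>x. queue (clamp x)) n n \<le> scaled_cost k (\<lambda>x. queue (clamp x)) n y"
proof -
  define x where "x = clamp y"
  have x: "x \<in> {0..N}" "clamp x = x" "clamp n = n"
    using clamp_in n N_pos by (auto simp: x_def clamp_def)
  \<comment> \<open>Clamping a position moves it no farther from \<open>k\<close> and leaves the
    queue unchanged, so it suffices to treat positions in \<open>{0..N}\<close>.\<close>
  have "max (k - x) 0 \<le> max (k - y) 0" "max (x - k) 0 \<le> max (y - k) 0"
    using k by (auto simp: x_def clamp_def)
  then have "\<beta> n * max (k - x) 0 \<le> \<beta> n * max (k - y) 0" "\<gamma> n * max (x - k) 0 \<le> \<gamma> n * max (y - k) 0"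
    using \<beta>_bounds[OF n] \<gamma>_pos[OF n] by (auto intro!: mult_left_mono)
  then have clamped: "scaled_cost k (\<lambda>x. queue (clamp x)) n x
      \<le> scaled_cost k (\<lambda>x. queue (clamp x)) n y"
    using x by (simp add: scaled_cost_def flip: x_def)
  have "scaled_cost k (\<lambda>x. queue (clamp x)) n n \<le> scaled_cost k (\<lambda>x. queue (clamp x)) n x"
  proof (cases "n \<le> k")
    case True
    then have lhs: "scaled_cost k (\<lambda>x. queue (clamp x)) n n = early n + \<beta> n * (k - n)"
      using queue_early[OF k, of n] n x by (simp add: scaled_cost_def)
    show ?thesis
    proof (cases "x \<le> k")
      case True
      then have "scaled_cost k (\<lambda>x. queue (clamp x)) n x = early x + \<beta> n * (k - x)"
        using queue_early[OF k, of x] x by (simp add: scaled_cost_def)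
      then show ?thesis using lhs early_bound[OF n x(1)] by (simp add: algebra_simps)
    next
      case False
      then have "scaled_cost k (\<lambda>x. queue (clamp x)) n x = late x + \<gamma> n * (x - k)"
        using queue_late[OF k, of x] x by (simp add: scaled_cost_def)
      \<comment> \<open>The tangent at \<open>k\<close> has slope \<open>- \<gamma> k\<close>, while
        the lateness of traveler \<open>n\<close> is charged at the higher rate
        \<open>\<gamma> n\<close>.\<close>
      moreover have "\<gamma> k * (x - k) \<le> \<gamma> n * (x - k)"
        using False \<gamma>_ge[OF n k(1) \<open>n \<le> k\<close>] by (intro mult_right_mono) auto
      ultimately show ?thesis
        using lhs early_bound[OF n k(1)] late_bound[OF k(1) x(1)] k(2) by simp
    qed
  next
    case False
    then have lhs: "scaled_cost k (\<lambda>x. queue (clamp x)) n n = late n + \<gamma> n * (n - k)"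
      using queue_late[OF k, of n] n x by (simp add: scaled_cost_def)
    show ?thesis
    proof (cases "x \<ge> k")
      case True
      then have "scaled_cost k (\<lambda>x. queue (clamp x)) n x = late x + \<gamma> n * (x - k)"
        using queue_late[OF k, of x] x by (simp add: scaled_cost_def)
      then show ?thesis using lhs late_bound[OF n x(1)] by (simp add: algebra_simps)
    next
      case xk: False
      then have "scaled_cost k (\<lambda>x. queue (clamp x)) n x = early x + \<beta> n * (k - x)"
        using queue_early[OF k, of x] x by (simp add: scaled_cost_def)
      moreover have "\<beta> k * (k - x) \<le> \<beta> n * (k - x)"
        using xk False \<beta>_le[OF k(1) n] by (intro mult_right_mono) auto
      ultimately show ?thesis
        using lhs early_bound[OF k(1) x(1)] late_bound[OF n k(1)] k(2)
        by (simp add: algebra_simps)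
    qed
  qed
  with clamped show ?thesis by linarith
qed

lemma time_window_iff: "u \<in> time_window N s \<longleftrightarrow> \<bar>s * u\<bar> \<le> N"
  using s_pos by (auto simp: time_window_def field_simps abs_le_iff)

lemma position_in_window:
  "k \<in> {0..N} \<Longrightarrow> n \<in> {0..N} \<Longrightarrow> (n - k) / s \<in> time_window N s"
  using s_pos by (auto simp: time_window_iff)

text \<open>\<open>queue\<close> is positive inside \<open>{0..N}\<close>, and \<open>clamp\<close>
  sends every other position to an endpoint, where it is zero. The support width, the capacity
  equality and the arrivals under an active queue all rest on this.\<close>

lemma eq_queue_pos_iff:
  assumes "k \<in> {0..N}" "u \<in> time_window N s"
  shows "0 < eq_queue k u \<longleftrightarrow> 0 < k + s * u \<and> k + s * u < N"
proof -
  consider "k + s * u \<le> 0" | "0 < k + s * u" "k + s * u < N" | "N \<le> k + s * u" by linarith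
  then show ?thesis
    using assms s_pos N_pos queue_pos[of "k + s * u"]
    by cases (auto simp: eq_queue_def clamp_def queue_0 queue_N)
qed

text \<open>Arrival times are affine in the index with slope \<open>1 / s\<close>, so the capacity
  clause is the scaling of Lebesgue measure; first-in, first-out comes from
  \<open>queue_growth\<close>.\<close>

lemma eq_feasible:
  assumes k: "k \<in> {0..N}"
  shows "feasible N s (eq_queue k) (eq_time k)"
  unfolding feasible_def
proof (intro conjI allI impI ballI)
  show "eq_queue k \<in> time_window N s \<rightarrow>\<^sub>E {0..}"
    using s_pos queue_nonneg[OF clamp_in] by (auto simp: eq_queue_def)
  show "eq_time k \<in> {0..N} \<rightarrow>\<^sub>E time_window N s"
    using position_in_window[OF k] by (auto simp: eq_time_def)
  show "inj_on (eq_time k) {0..N}"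
    using s_pos by (auto simp: inj_on_def eq_time_def)
  have "(\<lambda>n. (n - k) / s) \<in> borel_measurable (lebesgue_on {0..N})"
    by (intro continuous_imp_measurable_on_sets_lebesgue continuous_intros) (use s_pos in auto)
  then show "eq_time k \<in> borel_measurable (lebesgue_on {0..N})"
    by (rule measurable_cong[THEN iffD1, rotated]) (simp add: eq_time_def)
  have "{u \<in> time_window N s. 0 < eq_queue k u} = {- k / s<..<(N - k) / s}"
    using k s_pos eq_queue_pos_iff[OF k]
    by (auto simp: time_window_iff field_simps abs_le_iff)
  then show "measure lebesgue {u \<in> time_window N s. 0 < eq_queue k u} \<le> N / s"
    using s_pos N_pos by (simp add: field_simps)
  show "eq_queue k t2 - eq_queue k t1 < t2 - t1"
    if t: "t1 \<in> time_window N s" "t2 \<in> time_window N s" "t1 < t2" for t1 t2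
  proof -
    define x y where "x = clamp (k + s * t1)" and "y = clamp (k + s * t2)"
    have st: "s * t1 < s * t2" using t s_pos by simp
    have "queue y - queue x < s * t2 - s * t1"
    \<comment> \<open>If \<open>x = y\<close>, both positions were clamped to the same endpoint: the
      queue does not change while time advances.\<close>
    proof (cases "x = y")
      case False
      then have "x < y" "y - x \<le> s * t2 - s * t1"
        using st by (auto simp: x_def y_def clamp_def)
      then show ?thesis using queue_growth[of x y] clamp_in by (auto simp: x_def y_def)
    qed (use st in simp)
    then show ?thesis
      using t s_pos by (simp add: eq_queue_def field_simps flip: x_def y_def)
  qed
  show "\<exists>n\<in>{0..N}. eq_time k n = u" if u: "u \<in> time_window N s" "0 < eq_queue k u" for u
    using eq_queue_pos_iff[OF k u(1)] u(2) s_pos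
    by (intro bexI[of _ "k + s * u"]) (auto simp: eq_time_def)
next
  fix I assume "is_interval I \<and> I \<subseteq> time_window N s"
  then have I: "convex I" "I \<subseteq> time_window N s" by (auto simp: is_interval_convex_1)
  then have "bounded I" unfolding time_window_def by (meson bounded_closed_interval bounded_subset)
  then have lI: "I \<in> lmeasurable" using I by (intro measurable_convex)
  \<comment> \<open>Arrivals fill exactly this range of times. Hence the travelers arriving in
    \<open>I\<close> form the affine image of \<open>J\<close>, and under an active queue
    \<open>J\<close> is all of \<open>I\<close>.\<close>
  define J where "J = I \<inter> {- k / s..(N - k) / s}"
  have lJ: "J \<in> lmeasurable" unfolding J_def
    using lI by (intro fmeasurable.Int) auto
  have "{n \<in> {0..N}. eq_time k n \<in> I} = (\<lambda>u. k + s *\<^sub>R u) ` J"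
  proof (intro equalityI subsetI)
    fix n assume n: "n \<in> {n \<in> {0..N}. eq_time k n \<in> I}"
    then have "(n - k) / s \<in> J" "n = k + s *\<^sub>R ((n - k) / s)"
      using s_pos by (auto simp: J_def eq_time_def pos_divide_le_eq pos_le_divide_eq)
    then show "n \<in> (\<lambda>u. k + s *\<^sub>R u) ` J" by blast
  next
    fix n assume "n \<in> (\<lambda>u. k + s *\<^sub>R u) ` J"
    then show "n \<in> {n \<in> {0..N}. eq_time k n \<in> I}"
      using s_pos by (auto simp: J_def eq_time_def field_simps)
  qed
  then have meas: "measure lebesgue {n \<in> {0..N}. eq_time k n \<in> I} = s * measure lebesgue J"
    using measure_lebesgue_affine[of s k J] s_pos by (simp add: add.commute)
  show "measure lebesgue {n \<in> {0..N}. eq_time k n \<in> I} \<le> s * measure lebesgue I"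
    unfolding meas using s_pos lJ lI
    by (intro mult_left_mono measure_mono_fmeasurable) (auto simp: J_def)
  show "measure lebesgue {n \<in> {0..N}. eq_time k n \<in> I} = s * measure lebesgue I"
    if pos: "\<forall>u\<in>I. 0 < eq_queue k u"
  proof -
    have "J = I"
      using pos I eq_queue_pos_iff[OF k] s_pos by (force simp: J_def field_simps)
    then show ?thesis using meas by simp
  qed
qed

lemma eq_equilibrium:
  assumes k: "k \<in> {0..N}" "early k = late k"
  shows "equilibrium N s \<beta> \<gamma> (eq_queue k) (eq_time k)"
  unfolding equilibrium_def is_arg_min_linorder
proof (intro conjI ballI allI impI)
  fix n assume n: "n \<in> {0..N}"
  then show "eq_time k n \<in> time_window N s"
    using position_in_window[OF k(1)] by (simp add: eq_time_def)
  fix u assume u: "u \<in> time_window N s"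
  have cost: "s * travel_cost \<beta> \<gamma> (eq_queue k) n ((x - k) / s)
      = scaled_cost k (\<lambda>x. queue (clamp x)) n x" if "(x - k) / s \<in> time_window N s" for x
    using that s_pos unfolding travel_cost_scaled by (simp add: scaled_cost_def eq_queue_def)
  have "u = (k + s * u - k) / s" using s_pos by simp
  then have "s * travel_cost \<beta> \<gamma> (eq_queue k) n (eq_time k n)
      \<le> s * travel_cost \<beta> \<gamma> (eq_queue k) n u"
    using cost[of n] cost[of "k + s * u"] position_in_window[OF k(1) n]
      scaled_cost_minimal[OF k n, of "k + s * u"] n u by (simp add: eq_time_def)
  then show "travel_cost \<beta> \<gamma> (eq_queue k) n (eq_time k n) \<le> travel_cost \<beta> \<gamma> (eq_queue k) n u"
    using s_pos by simp
qed (rule eq_feasible[OF k(1)])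

section \<open>Uniqueness: every equilibrium is the candidate\<close>

lemma equilibrium_minimal:
  assumes "equilibrium N s \<beta> \<gamma> Q t" "n \<in> {0..N}" "u \<in> time_window N s"
  shows "travel_cost \<beta> \<gamma> Q n (t n) \<le> travel_cost \<beta> \<gamma> Q n u"
  using assms unfolding equilibrium_def is_arg_min_linorder by blast

text \<open>Single crossing: the cost difference between travelers \<open>n < m\<close> at a common arrival time
  is strictly increasing in that time.\<close>

lemma equilibrium_order:
  assumes eq: "equilibrium N s \<beta> \<gamma> Q t" and n: "n \<in> {0..N}" and m: "m \<in> {0..N}" and "n < m"
  shows "t n < t m"
proof (rule ccontr)
  assume "\<not> t n < t m"
  have feas: "inj_on t {0..N}" "t \<in> {0..N} \<rightarrow> time_window N s"
    using eq by (auto simp: equilibrium_def feasible_def)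
  define u v where "u = t n" and "v = t m"
  have "v < u"
    using \<open>\<not> t n < t m\<close> inj_onD[OF feas(1) _ n m] \<open>n < m\<close> by (force simp: u_def v_def)
  have "u \<in> time_window N s" "v \<in> time_window N s" using feas n m by (auto simp: u_def v_def)
  \<comment> \<open>The two optimality conditions are added; the queue terms occur on both sides and
    cancel, leaving only the penalties.\<close>
  then have "travel_cost \<beta> \<gamma> Q n u + travel_cost \<beta> \<gamma> Q m v
      \<le> travel_cost \<beta> \<gamma> Q n v + travel_cost \<beta> \<gamma> Q m u"
    using equilibrium_minimal[OF eq n] equilibrium_minimal[OF eq m]
    by (force simp: u_def v_def intro: add_mono)
  then have "(\<beta> m - \<beta> n) * (max (- v) 0 - max (- u) 0) + (\<gamma> n - \<gamma> m) * (max u 0 - max v 0) \<le> 0"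
    by (simp add: travel_cost_def algebra_simps)
  moreover have pos: "0 < \<beta> m - \<beta> n" "0 < \<gamma> n - \<gamma> m"
    using strict_mono_onD[OF \<beta>_mono n m \<open>n < m\<close>] monotone_onD[OF \<gamma>_anti n m \<open>n < m\<close>] by auto
  moreover have "0 \<le> max (- v) 0 - max (- u) 0" "0 \<le> max u 0 - max v 0"
    "0 < max (- v) 0 - max (- u) 0 \<or> 0 < max u 0 - max v 0"
    using \<open>v < u\<close> by auto
  ultimately show False
    by (smt (verit) mult_pos_pos mult_nonneg_nonneg)
qed

text \<open>Without a queue at time 0, arriving then would be free and any other time would cost
  something, so all travelers would arrive at once, against
  \<open>equilibrium_order\<close>.\<close>

lemma equilibrium_queue_0_pos:
  assumes eq: "equilibrium N s \<beta> \<gamma> Q t"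
  shows "0 < Q 0"
proof (rule ccontr)
  assume neg: "\<not> 0 < Q 0"
  have ran: "Q \<in> time_window N s \<rightarrow> {0..}" "t \<in> {0..N} \<rightarrow> time_window N s"
    using eq by (auto simp: equilibrium_def feasible_def)
  have "t n = 0" if n: "n \<in> {0..N}" for n
  proof (rule ccontr)
    assume "t n \<noteq> 0"
    have "travel_cost \<beta> \<gamma> Q n (t n) \<le> 0"
      using equilibrium_minimal[OF eq n, of 0] neg N_pos by (simp add: travel_cost_def time_window_iff)
    moreover have "0 \<le> Q (t n)" using ran n by auto
    moreover have "0 < \<beta> n * max (- t n) 0 + \<gamma> n * max (t n) 0"
      using \<open>t n \<noteq> 0\<close> \<beta>_bounds[OF n] \<gamma>_pos[OF n]
      by (cases "t n < 0") (auto simp: mult_neg_pos max_def mult_less_0_iff)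
    ultimately show False by (simp add: travel_cost_def)
  qed
  then show False using equilibrium_order[OF eq, of 0 N] N_pos by auto
qed

text \<open>There is an active queue between the arrival of a traveler and the preferred time, since
  otherwise arriving at a queue-free moment in between would be cheaper.\<close>

lemma equilibrium_times:
  assumes eq: "equilibrium N s \<beta> \<gamma> Q t"
  obtains k where "k \<in> {0..N}" "t = eq_time k"
proof -
  have ran: "Q \<in> time_window N s \<rightarrow> {0..}" "t \<in> {0..N} \<rightarrow>\<^sub>E time_window N s"
    and cap: "\<And>I. is_interval I \<Longrightarrow> I \<subseteq> time_window N s \<Longrightarrow> \<forall>u\<in>I. 0 < Q u \<Longrightarrow>
      measure lebesgue {n \<in> {0..N}. t n \<in> I} = s * measure lebesgue I"
    and arr: "\<And>u. u \<in> time_window N s \<Longrightarrow> 0 < Q u \<Longrightarrow> \<exists>n\<in>{0..N}. t n = u"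
    using eq by (auto simp: equilibrium_def feasible_def)
  obtain k where k: "k \<in> {0..N}" "t k = 0"
    using arr[of 0] equilibrium_queue_0_pos[OF eq] N_pos by (auto simp: time_window_iff)
  have less_iff: "t n < t m \<longleftrightarrow> n < m" if "n \<in> {0..N}" "m \<in> {0..N}" for n m
    using equilibrium_order[OF eq that] equilibrium_order[OF eq that(2,1)]
    by (cases n m rule: linorder_cases) auto
  have t_eq: "t n = (n - k) / s" if n: "n \<in> {0..N}" for n
  proof -
    have tn: "t n \<in> time_window N s" using ran n by auto
    \<comment> \<open>By order preservation, the travelers arriving strictly between
      \<open>t m\<close> and \<open>t m'\<close> are those with index strictly between
      \<open>m\<close> and \<open>m'\<close>; discharge at capacity then relates the two
      lengths.\<close>
    have rate: "m' - m = s * (t m' - t m)"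
      if m: "m \<in> {0..N}" "m' \<in> {0..N}" "m \<le> m'" and pos: "\<forall>u\<in>{t m<..<t m'}. 0 < Q u" for m m'
    proof -
      have "{n \<in> {0..N}. t n \<in> {t m<..<t m'}} = {m<..<m'}"
        using m less_iff by auto
      moreover have "{t m<..<t m'} \<subseteq> time_window N s"
      proof -
        have "t m \<in> time_window N s" "t m' \<in> time_window N s" using ran(2) m by blast+
        then show ?thesis unfolding time_window_def by auto
      qed
      moreover have "t m \<le> t m'" using less_iff[of m m'] m by (cases "m = m'") auto
      ultimately show ?thesis
        using cap[OF is_interval_oo _ pos] m(3) by simp
    qed
    have free: "0 < Q u" if u: "t n < u \<and> u < 0 \<or> 0 < u \<and> u < t n" for u
    proof (rule ccontr)
      assume "\<not> 0 < Q u"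
      have "u \<in> time_window N s" using u tn unfolding time_window_def by auto
      then have "travel_cost \<beta> \<gamma> Q n (t n) \<le> travel_cost \<beta> \<gamma> Q n u"
        using equilibrium_minimal[OF eq n] by blast
      moreover have "Q u \<le> Q (t n)" using \<open>\<not> 0 < Q u\<close> ran(1) tn by force
      moreover have "\<beta> n * max (- u) 0 + \<gamma> n * max u 0 < \<beta> n * max (- t n) 0 + \<gamma> n * max (t n) 0"
        using u \<beta>_bounds[OF n] \<gamma>_pos[OF n] by auto
      ultimately show False by (simp add: travel_cost_def)
    qed
    have "n - k = s * t n"
    proof (cases "n \<le> k")
      case True
      then show ?thesis using rate[OF n k(1)] free k(2) by auto
    next
      case False
      then show ?thesis using rate[OF k(1) n] free k(2) by auto
    qed
    then show ?thesis using s_pos by simp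
  qed
  have "t = eq_time k"
    using ran(2) t_eq unfolding eq_time_def by (auto simp: fun_eq_iff PiE_def extensional_def)
  with k show ?thesis using that by blast
qed

text \<open>The subgradient conditions fix the rescaled queue \<open>R\<close> up to a constant on
  each side of \<open>k\<close>. The delicate point is that \<open>R\<close> vanishes at
  \<open>0\<close> and at \<open>N\<close>, where it might a priori jump.\<close>

lemma equilibrium_eq:
  assumes eq: "equilibrium N s \<beta> \<gamma> Q t"
  obtains k where "k \<in> {0..N}" "early k = late k" "Q = eq_queue k" "t = eq_time k"
proof -
  obtain k where k: "k \<in> {0..N}" and t: "t = eq_time k" using equilibrium_times[OF eq] .
  define R where "R = (\<lambda>x. s * Q ((x - k) / s))"
  have ran: "Q \<in> time_window N s \<rightarrow>\<^sub>E {0..}"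
    and fifo: "\<And>u v. u \<in> time_window N s \<Longrightarrow> v \<in> time_window N s \<Longrightarrow> u < v \<Longrightarrow> Q v - Q u < v - u"
    and arr: "\<And>u. u \<in> time_window N s \<Longrightarrow> 0 < Q u \<Longrightarrow> \<exists>n\<in>{0..N}. t n = u"
    using eq by (auto simp: equilibrium_def feasible_def)
  have window: "(x - k) / s \<in> time_window N s \<longleftrightarrow> k - N \<le> x \<and> x \<le> k + N" for x
    using s_pos by (auto simp: time_window_iff abs_le_iff)
  have R_nonneg: "0 \<le> R x" if "k - N \<le> x" "x \<le> k + N" for x
  proof -
    have "(x - k) / s \<in> time_window N s" using that window by blast
    then have "Q ((x - k) / s) \<in> {0..}" using ran by blast
    then show ?thesis using s_pos by (simp add: R_def)
  qed
  \<comment> \<open>An active queue implies an arrival, and arrivals under \<open>eq_time k\<close>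
    occupy only the positions in \<open>{0..N}\<close>.\<close>
  have R_out: "R x = 0" if x: "k - N \<le> x" "x \<le> k + N" "x \<notin> {0..N}" for x
  proof (rule ccontr)
    assume "R x \<noteq> 0"
    then have "0 < Q ((x - k) / s)"
      using R_nonneg[OF x(1,2)] s_pos by (auto simp: R_def zero_le_mult_iff order_less_le)
    then obtain n where "n \<in> {0..N}" "t n = (x - k) / s"
      using arr[of "(x - k) / s"] window[of x] x(1,2) by auto
    then have "n = x" using s_pos by (simp add: t eq_time_def)
    then show False using x(3) \<open>n \<in> {0..N}\<close> by simp
  qed
  have R_min: "scaled_cost k R n n \<le> scaled_cost k R n x"
    if "n \<in> {0..N}" "k - N \<le> x" "x \<le> k + N" for n x
  proof -
    have "s * travel_cost \<beta> \<gamma> Q n ((n - k) / s) \<le> s * travel_cost \<beta> \<gamma> Q n ((x - k) / s)"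
      using equilibrium_minimal[OF eq that(1), of "(x - k) / s"] that window s_pos
      by (simp add: t eq_time_def)
    then show ?thesis unfolding travel_cost_scaled R_def .
  qed
  have R_0: "R 0 = 0" if "k < N"
  proof (rule ccontr)
    assume "R 0 \<noteq> 0"
    then have "0 < R 0" using R_nonneg[of 0] k by auto
    \<comment> \<open>First-in, first-out excludes an upward jump at \<open>0\<close>: it gives
      \<open>R 0 < e\<close>, although \<open>e\<close> is at most \<open>R 0\<close>. The bound
      \<open>N - k\<close> keeps position \<open>- e\<close> in the window.\<close>
    define e where "e = min (R 0) (N - k)"
    have e: "0 < e" "e \<le> R 0" "e \<le> N - k" using \<open>0 < R 0\<close> that by (auto simp: e_def)
    have "Q ((0 - k) / s) - Q ((- e - k) / s) < (0 - k) / s - (- e - k) / s"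
      using e s_pos k by (intro fifo window[THEN iffD2] divide_strict_right_mono) auto
    also have "\<dots> = e / s" by (simp add: diff_divide_distrib)
    finally have "R 0 - R (- e) < e" using s_pos by (simp add: R_def field_simps)
    then show False using R_out[of "- e"] e k by auto
  qed
  have R_N: "R N = 0" if "0 < k"
  proof (rule ccontr)
    assume "R N \<noteq> 0"
    then have "0 < R N" using R_nonneg[of N] k by auto
    \<comment> \<open>Downward jumps are allowed, so optimality is used at \<open>N\<close>:
      arriving later by \<open>e\<close> positions would save traveler \<open>N\<close> all of
      \<open>R N\<close> for extra lateness of at most \<open>R N / 2\<close>. The bound
      \<open>k\<close> keeps \<open>N + e\<close> in the window.\<close>
    define e where "e = min (R N / (2 * \<gamma> N)) k"
    have \<gamma>: "0 < \<gamma> N" using \<gamma>_pos N_pos by auto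
    have e: "0 < e" "e \<le> k" "e \<le> R N / (2 * \<gamma> N)" using \<open>0 < R N\<close> \<gamma> that by (auto simp: e_def)
    have "scaled_cost k R N N \<le> scaled_cost k R N (N + e)"
      using e k N_pos by (intro R_min) auto
    then have "R N \<le> \<gamma> N * e"
      using R_out[of "N + e"] e k by (simp add: scaled_cost_def algebra_simps)
    moreover have "\<gamma> N * e \<le> R N / 2" using e(3) \<gamma> by (simp add: field_simps)
    ultimately show False using \<open>0 < R N\<close> by simp
  qed
  have "0 < R k" using equilibrium_queue_0_pos[OF eq] s_pos by (simp add: R_def)
  \<comment> \<open>If \<open>k\<close> were an endpoint, \<open>R_0\<close> or \<open>R_N\<close>
    would make \<open>R k\<close> zero. With \<open>k\<close> interior, both boundary values are
    available.\<close>
  then have k': "0 < k" "k < N"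
    using R_0 R_N k N_pos by (cases "k = 0"; cases "k = N"; auto)+
  \<comment> \<open>Up to \<open>k\<close> there is no lateness, so minimality for traveler
    \<open>x\<close> reads
    \<open>R x + \<beta> x * (k - x) \<le> R y + \<beta> x * (k - y)\<close>.\<close>
  have "subgradient_on {0..k} \<beta> R"
    unfolding subgradient_on_def
  proof (intro ballI)
    fix x y assume "x \<in> {0..k}" "y \<in> {0..k}"
    then show "R x + \<beta> x * (y - x) \<le> R y"
      using R_min[of x y] k by (simp add: scaled_cost_def algebra_simps)
  qed
  moreover have "subgradient_on {0..k} \<beta> early" "continuous_on {0..k} \<beta>"
    using k early_subgradient \<beta>_cont by (auto intro: subgradient_on_subset continuous_on_subset)
  ultimately have R_early: "R x = early x" if "x \<in> {0..k}" for x
    using subgradient_on_unique[of "{0..k}" \<beta> R early x 0] that R_0 k' early_0 by auto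
  have "subgradient_on {k..N} (\<lambda>n. - \<gamma> n) R"
    unfolding subgradient_on_def
  proof (intro ballI)
    fix x y assume "x \<in> {k..N}" "y \<in> {k..N}"
    then show "R x + - \<gamma> x * (y - x) \<le> R y"
      using R_min[of x y] k by (simp add: scaled_cost_def algebra_simps)
  qed
  moreover have "subgradient_on {k..N} (\<lambda>n. - \<gamma> n) late" "continuous_on {k..N} (\<lambda>n. - \<gamma> n)"
    using k late_subgradient \<gamma>_cont
    by (auto intro: subgradient_on_subset continuous_on_minus continuous_on_subset)
  ultimately have R_late: "R x = late x" if "x \<in> {k..N}" for x
    using subgradient_on_unique[of "{k..N}" "\<lambda>n. - \<gamma> n" R late x N] that R_N k' late_N by auto
  have bal: "early k = late k" using R_early[of k] R_late[of k] k by simp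
  have R_queue: "R x = queue (clamp x)" if "k - N \<le> x" "x \<le> k + N" for x
  proof -
    consider "x < 0" | "x \<in> {0..k}" | "x \<in> {k..N}" | "N < x" by fastforce
    then show ?thesis
      using R_out[OF that] R_early[of x] R_late[of x] queue_early[OF k bal, of x]
        queue_late[OF k bal, of x] queue_0 queue_N k N_pos
      by cases (auto simp: clamp_def)
  qed
  have "Q u = eq_queue k u" for u
  proof (cases "u \<in> time_window N s")
    case True
    then have "R (k + s * u) = queue (clamp (k + s * u))"
      by (intro R_queue) (auto simp: time_window_iff abs_le_iff)
    then show ?thesis using True s_pos by (simp add: R_def eq_queue_def field_simps)
  next
    case False
    then show ?thesis using ran by (auto simp: eq_queue_def PiE_def extensional_def)
  qed
  then show ?thesis using that k bal t by blast
qed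

end

theorem theorem2:
  fixes N s :: real and \<beta> \<gamma> :: "real \<Rightarrow> real"
  assumes "N > 0" and "s > 0"
    and "\<beta> \<in> {0..N} \<rightarrow> {0<..<1}" and "continuous_on {0..N} \<beta>" and "strict_mono_on {0..N} \<beta>"
    and "\<gamma> \<in> {0..N} \<rightarrow> {0<..}" and "continuous_on {0..N} \<gamma>" and "strict_antimono_on {0..N} \<gamma>"
  shows "\<exists>!(Q, t). equilibrium N s \<beta> \<gamma> Q t"
proof -
  interpret bottleneck N s \<beta> \<gamma> using assms by unfold_locales
  obtain k where k: "k \<in> {0..N}" "early k = late k" using balance_exists by blast
  \<comment> \<open>Each equilibrium comes with its own balance point, which
    \<open>balance_unique\<close> identifies with \<open>k\<close>.\<close>
  have "Q = eq_queue k \<and> t = eq_time k" if "equilibrium N s \<beta> \<gamma> Q t" for Q t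
    using equilibrium_eq[OF that] balance_unique[OF k] by metis
  then have "equilibrium N s \<beta> \<gamma> Q t \<longleftrightarrow> (Q, t) = (eq_queue k, eq_time k)" for Q t
    using eq_equilibrium[OF k] by blast
  then have "(\<lambda>(Q, t). equilibrium N s \<beta> \<gamma> Q t) = (\<lambda>p. p = (eq_queue k, eq_time k))"
    by (simp add: fun_eq_iff)
  then show ?thesis by simp
qed

end
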